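(* For every $n\ge 3$, we have $\operatorname{cr}(S_n)=3n$, where $S_n$ is the star on $n$ vertices.
   Context: All graphs are finite, simple, undirected and labelled. The star $S_n$ on $n$ vertices consists of one center adjacent to each of the $n-1$ other vertices (leaves), with no other edges. A bicoloration (bicoloring) of a graph $G$ is a map $\beta:V(G)\to\{-1,1\}$, and a bicolored graph is a pair $B=(G,\beta)$. The local complement $G*a$ of $G$ at a vertex $a$ is obtained from $G$ by complementing the subgraph induced by the open neighborhood $N_G(a)$ and leaving all other adjacencies unchanged. The local inversion of $B=(G,\beta)$ at $a\in V(G)$ is $B_a=(G*a,\beta_a)$, where $\beta_a(x)=-\beta(x)$ if $x\in N_G(a)$ and $\beta_a(x)=\beta(x)$ otherwise. A string is a finite (possibly empty) sequence of vertices of $G$ (repetitions allowed); for a string $w=x_1\cdots x_k$ its length is $|w|=k$, and $B_w$ is the bicolored graph obtained from $B$ by applying the local inversions at $x_1,\ldots,x_k$ in this order, each neighborhood being taken in the current underlying graph. The color-reversal number $\operatorname{cr}(G)$ is the minimum length of a string $w$ of vertices of $G$ such that, for every bicoloring $\beta$ of $G$, $(G,\beta)_w=(G,-\beta)$, i.e. applying the local inversions in $w$ returns the underlying graph to $G$ and changes every color. (The effect of a fixed string on which colors are changed is independent of the initial coloring, so it is equivalent to require this for one bicoloring.) *)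

theory Defs
  imports "HOL-Library.FuncSet" "HOL-Library.Extended_Nat"
begin

record 'a graph =
  verts :: "'a set"
  adj :: "'a \<Rightarrow> 'a \<Rightarrow> bool"

definition simple_graph :: "'a graph \<Rightarrow> bool" where
  "simple_graph G \<longleftrightarrow>
     finite (verts G) \<and>
     (\<forall>x y. adj G x y \<longrightarrow> x \<in> verts G \<and> y \<in> verts G) \<and>
     (\<forall>x y. adj G x y \<longrightarrow> adj G y x) \<and>
     (\<forall>x. \<not> adj G x x)"

definition nbhd :: "'a graph \<Rightarrow> 'a \<Rightarrow> 'a set" where
  "nbhd G a = {x \<in> verts G. adj G a x}"

definition is_star :: "nat \<Rightarrow> 'a graph \<Rightarrow> bool" where
  "is_star n G \<longleftrightarrow>
     simple_graph G \<and> card (verts G) = n \<and>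
     (\<exists>c \<in> verts G. \<forall>x y. adj G x y \<longleftrightarrow>
        (x = c \<and> y \<in> verts G - {c}) \<or> (y = c \<and> x \<in> verts G - {c}))"

text \<open>Colorings are functions on the vertex set in the sense of \<^const>\<open>PiE\<close>, i.e. they are
  \<^const>\<open>undefined\<close> elsewhere, so equality of bicolored graphs is plain equality.\<close>

definition bicolorings :: "'a graph \<Rightarrow> ('a \<Rightarrow> int) set" where
  "bicolorings G = verts G \<rightarrow>\<^sub>E {-1, 1}"

definition local_complement :: "'a graph \<Rightarrow> 'a \<Rightarrow> 'a graph" where
  "local_complement G a =
     G\<lparr>adj := (\<lambda>x y. if x \<in> nbhd G a \<and> y \<in> nbhd G a \<and> x \<noteq> y
                      then \<not> adj G x y else adj G x y)\<rparr>"

type_synonym 'a bicolored = "'a graph \<times> ('a \<Rightarrow> int)"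

definition local_inversion :: "'a bicolored \<Rightarrow> 'a \<Rightarrow> 'a bicolored" where
  "local_inversion B a =
     (local_complement (fst B) a,
      \<lambda>x. if x \<in> nbhd (fst B) a then - snd B x else snd B x)"

definition apply_string :: "'a bicolored \<Rightarrow> 'a list \<Rightarrow> 'a bicolored" where
  "apply_string B w = foldl local_inversion B w"

definition color_reversing :: "'a graph \<Rightarrow> 'a list \<Rightarrow> bool" where
  "color_reversing G w \<longleftrightarrow>
     set w \<subseteq> verts G \<and>
     (\<forall>\<beta> \<in> bicolorings G. apply_string (G, \<beta>) w = (G, \<lambda>x \<in> verts G. - \<beta> x))"

text \<open>The value is \<^term>\<open>\<infinity>\<close> if no color-reversing string exists (e.g. for a graph with an
  isolated vertex); otherwise the infimum in \<^typ>\<open>enat\<close> is attained and hence a minimum.\<close>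

definition cr :: "'a graph \<Rightarrow> enat" where
  "cr G = (INF w \<in> {w. color_reversing G w}. enat (length w))"

end

theory Submission
  imports Defs
begin

text \<open>
  Starting from a star, local inversions only ever produce the stars on the same vertex set and
  the complete graph. Call a vertex a hub if it is adjacent to all the others, so that the hub
  set is \<open>{d}\<close> for the star with center \<open>d\<close>, and \<open>V\<close> for the complete graph. There are two
  kinds of moves. Inverting at a hub \<open>a\<close> exchanges the star at \<open>a\<close> and the complete graph, and the
  colors that change are exactly those of \<open>V - {a}\<close>, the symmetric difference of the two
  hub sets. Inverting at a leaf keeps the star and changes the color of its center only.

  Consequently hub moves telescope: if the graph returns to the original star, they have no net
  effect on the colors, and every vertex has to change its color through leaf moves, each of
  which happens while that vertex is the center. So all \<open>n\<close> vertices receive at least one leaf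
  move, and all of them are centers at some time. Becoming a center costs two hub moves, through
  the complete graph; this applies to the original center as well, because it has to become the
  center again after another vertex has been. The length is therefore at least \<open>n + 2 * n\<close>
  (\<open>color_reversing_length\<close>).

  Conversely, for distinct \<open>a\<close> and \<open>b\<close> the string \<open>b a b\<close> takes the star at \<open>a\<close> to the star at
  \<open>b\<close> and changes only the color of \<open>b\<close>. Moving the center once around a cyclic order of the
  vertices changes every color once and uses \<open>3 * n\<close> inversions (\<open>apply_tour\<close>).
\<close>

section \<open>The graphs reachable from a star\<close>

text \<open>The star with center \<open>d\<close> is the case \<open>H = {d}\<close>, the complete graph the case \<open>H = V\<close>.\<close>

definition hub_graph :: "'a set \<Rightarrow> 'a set \<Rightarrow> 'a graph" where
  "hub_graph V H =
     \<lparr>verts = V, adj = (\<lambda>x y. x \<in> V \<and> y \<in> V \<and> x \<noteq> y \<and> (x \<in> H \<or> y \<in> H))\<rparr>"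

definition flip :: "'a set \<Rightarrow> ('a \<Rightarrow> int) \<Rightarrow> 'a \<Rightarrow> int" where
  "flip S \<beta> = (\<lambda>x. if x \<in> S then - \<beta> x else \<beta> x)"

lemma is_starE:
  assumes "is_star n G"
  obtains V c where "finite V" "card V = n" "c \<in> V" "G = hub_graph V {c}"
proof -
  from assms obtain c where c: "c \<in> verts G" and adj: "\<And>x y. adj G x y \<longleftrightarrow>
      (x = c \<and> y \<in> verts G - {c}) \<or> (y = c \<and> x \<in> verts G - {c})"
    unfolding is_star_def by blast
  have "G = hub_graph (verts G) {c}"
    using c by (intro graph.equality) (auto simp: hub_graph_def fun_eq_iff adj)
  moreover have "finite (verts G)" "card (verts G) = n"
    using assms by (auto simp: is_star_def simple_graph_def)
  ultimately show thesis using that c by blast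
qed

lemma local_inversion_center:
  assumes "c \<in> V"
  shows "local_inversion (hub_graph V {c}, \<beta>) c = (hub_graph V V, flip (V - {c}) \<beta>)"
  using assms
  by (auto simp: local_inversion_def local_complement_def hub_graph_def nbhd_def flip_def fun_eq_iff)

lemma local_inversion_leaf:
  assumes "c \<in> V" "x \<in> V" "x \<noteq> c"
  shows "local_inversion (hub_graph V {c}, \<beta>) x = (hub_graph V {c}, flip {c} \<beta>)"
  using assms
  by (auto simp: local_inversion_def local_complement_def hub_graph_def nbhd_def flip_def fun_eq_iff)

lemma local_inversion_complete:
  assumes "a \<in> V"
  shows "local_inversion (hub_graph V V, \<beta>) a = (hub_graph V {a}, flip (V - {a}) \<beta>)"
  using assms
  by (auto simp: local_inversion_def local_complement_def hub_graph_def nbhd_def flip_def fun_eq_iff)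

text \<open>This fails for two vertices, where both stars coincide with the complete graph: two other
  vertices are needed to see which one is a hub.\<close>

lemma hub_graph_star_eqD:
  assumes "card V \<ge> 3" "c \<in> V" "hub_graph V H = hub_graph V {c}" "H \<subseteq> V" "H \<noteq> {}"
  shows "H = {c}"
proof -
  have "x = c" if "x \<in> H" for x
  proof (rule ccontr)
    assume "x \<noteq> c"
    have "card {x, c} < card V" using assms(1) \<open>x \<noteq> c\<close> by simp
    then obtain y where y: "y \<in> V" "y \<notin> {x, c}"
      by (metis card_mono finite.emptyI finite.insertI linorder_not_le subsetI)
    have "adj (hub_graph V H) x y" "\<not> adj (hub_graph V {c}) x y"
      using that y \<open>x \<noteq> c\<close> assms(4) by (auto simp: hub_graph_def)
    thus False using assms(3) by simp
  qed
  thus ?thesis using assms(5) by blast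
qed

section \<open>The lower bound\<close>

text \<open>Outside \<open>T\<close>, the set of vertices that have received a leaf move while being the center, only
  hub moves have acted, and these telescope to the symmetric difference of the first and the
  current hub set. The set \<open>A\<close> consists of the vertices that have been entered as center. An entry
  consists of two moves, and in the complete graph the first move of the next entry has already
  been made; the last clause of the conclusion records that the current center has been entered
  unless nothing has been.\<close>

lemma apply_string_star_invariant:
  assumes "card V \<ge> 2" "c \<in> V" "set w \<subseteq> V"
  shows "\<exists>H T A \<gamma>. apply_string (hub_graph V {c}, \<beta>) w = (hub_graph V H, \<gamma>) \<and>
    (\<forall>v \<in> V - T. \<gamma> v = (if (v = c) \<noteq> (v \<in> H) then - \<beta> v else \<beta> v)) \<and>
    T \<subseteq> insert c A \<and> A \<subseteq> V \<and>
    card T + 2 * card A + (if H = V then 1 else 0) \<le> length w \<and>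
    (H = V \<or> (\<exists>d \<in> V. H = {d} \<and> (d \<in> A \<or> A = {} \<and> d = c)))"
  using assms(3)
proof (induction w rule: rev_induct)
  case Nil
  have "V \<noteq> {c}" using assms(1) by auto
  thus ?case using assms(2)
    by (intro exI[of _ "{c}"] exI[of _ "{}"] exI[of _ \<beta>]) (auto simp: apply_string_def)
next
  case (snoc x w)
  have proper: "V \<noteq> {d}" for d using assms(1) by auto
  from snoc obtain H T A \<gamma>
    where run: "apply_string (hub_graph V {c}, \<beta>) w = (hub_graph V H, \<gamma>)"
      and col: "\<forall>v \<in> V - T. \<gamma> v = (if (v = c) \<noteq> (v \<in> H) then - \<beta> v else \<beta> v)"
      and TA: "T \<subseteq> insert c A" and AV: "A \<subseteq> V"
      and len: "card T + 2 * card A + (if H = V then 1 else 0) \<le> length w"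
      and H: "H = V \<or> (\<exists>d \<in> V. H = {d} \<and> (d \<in> A \<or> A = {} \<and> d = c))"
    by (auto simp del: split_paired_Ex)
  have x: "x \<in> V" using snoc.prems by simp
  have run': "apply_string (hub_graph V {c}, \<beta>) (w @ [x]) = local_inversion (hub_graph V H, \<gamma>) x"
    using run by (simp add: apply_string_def)
  consider (enter) "H = V" | (leave) "H = {x}" "x \<in> A \<or> A = {} \<and> x = c"
    | (leaf) d where "d \<in> V" "H = {d}" "x \<noteq> d" "d \<in> A \<or> A = {} \<and> d = c"
    using H by blast
  thus ?case
  proof cases
    case enter
    have "card (insert x A) \<le> Suc (card A)" by (rule card_insert_le_m1) auto
    hence "card T + 2 * card (insert x A) \<le> length (w @ [x])" using len enter by simp
    thus ?thesis
      using run' col TA AV x enter proper local_inversion_complete[OF x]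
      by (intro exI[of _ "{x}"] exI[of _ T] exI[of _ "insert x A"] exI[of _ "flip (V - {x}) \<gamma>"])
        (auto simp: flip_def)
  next
    case leave
    thus ?thesis
      using run' col TA AV x len proper[of x] local_inversion_center[OF x]
      by (intro exI[of _ V] exI[of _ T] exI[of _ A] exI[of _ "flip (V - {x}) \<gamma>"])
        (auto simp: flip_def)
  next
    case leaf
    have "card (insert d T) \<le> Suc (card T)" by (rule card_insert_le_m1) auto
    hence "card (insert d T) + 2 * card A \<le> length (w @ [x])" using len leaf proper[of d] by simp
    thus ?thesis
      using run' col TA AV x leaf proper[of d] local_inversion_leaf[OF leaf(1) x leaf(3)]
      by (intro exI[of _ "{d}"] exI[of _ "insert d T"] exI[of _ A] exI[of _ "flip {d} \<gamma>"])
        (auto simp: flip_def)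
  qed
qed

lemma color_reversing_length:
  assumes "card V \<ge> 3" "c \<in> V" "color_reversing (hub_graph V {c}) w"
  shows "3 * card V \<le> length w"
proof -
  define \<beta> :: "'a \<Rightarrow> int" where "\<beta> = (\<lambda>x \<in> V. 1)"
  have "\<beta> \<in> bicolorings (hub_graph V {c})"
    by (auto simp: bicolorings_def hub_graph_def \<beta>_def)
  hence rev: "apply_string (hub_graph V {c}, \<beta>) w = (hub_graph V {c}, \<lambda>x \<in> V. - \<beta> x)"
    and "set w \<subseteq> V"
    using assms(3) by (auto simp: color_reversing_def hub_graph_def)
  with assms obtain H T A \<gamma>
    where run: "apply_string (hub_graph V {c}, \<beta>) w = (hub_graph V H, \<gamma>)"
      and col: "\<forall>v \<in> V - T. \<gamma> v = (if (v = c) \<noteq> (v \<in> H) then - \<beta> v else \<beta> v)"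
      and TA: "T \<subseteq> insert c A" and AV: "A \<subseteq> V"
      and len: "card T + 2 * card A + (if H = V then 1 else 0) \<le> length w"
      and H: "H = V \<or> (\<exists>d \<in> V. H = {d} \<and> (d \<in> A \<or> A = {} \<and> d = c))"
    using apply_string_star_invariant[of V c w \<beta>] by (auto simp del: split_paired_Ex)
  have "H = {c}"
    using hub_graph_star_eqD[OF assms(1,2), of H] run rev H assms(2) by auto
  have "V \<subseteq> T"
  proof
    fix v assume "v \<in> V"
    have "\<gamma> v = - 1" using run rev \<open>v \<in> V\<close> by (auto simp: \<beta>_def)
    moreover have "\<gamma> v = 1" if "v \<notin> T"
      using col that \<open>v \<in> V\<close> \<open>H = {c}\<close> by (auto simp: \<beta>_def)
    ultimately show "v \<in> T" by auto
  qed
  moreover have "\<not> V \<subseteq> {c}"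
    using card_mono[of "{c}" V] assms(1) by auto
  ultimately have "A \<noteq> {}" using TA by auto
  \<comment> \<open>The center has moved and come back, so \<open>c\<close> has been entered, too.\<close>
  hence "c \<in> A" using H \<open>H = {c}\<close> assms(1) by auto
  hence "T = V" "A = V" using \<open>V \<subseteq> T\<close> TA AV by auto
  thus ?thesis using len by simp
qed

section \<open>A color-reversing string of minimum length\<close>

text \<open>Moves the center along the path \<open>a # bs\<close>. In each block the leaf move at \<open>b\<close> flips \<open>a\<close>, and
  the two hub moves flip \<open>a\<close> and \<open>b\<close>, which leaves a flip of \<open>b\<close> alone.\<close>

fun tour :: "'a \<Rightarrow> 'a list \<Rightarrow> 'a list" where
  "tour a [] = []"
| "tour a (b # bs) = [b, a, b] @ tour b bs"

lemma length_tour: "length (tour a bs) = 3 * length bs"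
  by (induction a bs rule: tour.induct) auto

lemma set_tour: "set (tour a bs) \<subseteq> set (a # bs)"
  by (induction a bs rule: tour.induct) auto

lemma apply_tour:
  assumes "a \<in> V" "set bs \<subseteq> V" "distinct_adj (a # bs)" "distinct bs"
  shows "apply_string (hub_graph V {a}, \<beta>) (tour a bs)
    = (hub_graph V {last (a # bs)}, flip (set bs) \<beta>)"
  using assms
proof (induction a bs arbitrary: \<beta> rule: tour.induct)
  case (1 a)
  show ?case by (simp add: apply_string_def flip_def)
next
  case (2 a b bs)
  have ab: "a \<in> V" "b \<in> V" "b \<noteq> a" using 2 by auto
  have "flip (V - {b}) (flip (V - {a}) (flip {a} \<beta>)) = flip {b} \<beta>"
    using ab by (auto simp: flip_def fun_eq_iff)
  hence "apply_string (hub_graph V {a}, \<beta>) (tour a (b # bs))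
      = apply_string (hub_graph V {b}, flip {b} \<beta>) (tour b bs)"
    using ab by (simp add: apply_string_def local_inversion_leaf local_inversion_center
        local_inversion_complete)
  also have "\<dots> = (hub_graph V {last (b # bs)}, flip (set bs) (flip {b} \<beta>))"
    using 2 by simp
  also have "flip (set bs) (flip {b} \<beta>) = flip (set (b # bs)) \<beta>"
    using 2 by (auto simp: flip_def fun_eq_iff)
  finally show ?case by simp
qed

lemma color_reversing_string_exists:
  assumes "finite V" "card V \<ge> 2" "c \<in> V"
  shows "\<exists>w. color_reversing (hub_graph V {c}) w \<and> length w = 3 * card V"
proof -
  obtain xs where xs: "set xs = V - {c}" "distinct xs"
    using finite_distinct_list[of "V - {c}"] assms(1) by auto
  have len: "Suc (length xs) = card V"
    using xs assms(1,3) by (metis card_Suc_Diff1 distinct_card)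
  hence "xs \<noteq> []" using assms(2) by auto
  let ?bs = "xs @ [c]"
  have bs: "set ?bs = V" "distinct ?bs" using xs assms(3) by auto
  have adj: "distinct_adj xs"
    using xs(2) by (auto simp: distinct_adj_conv_nth nth_eq_iff_index_eq)
  have "distinct_adj (c # ?bs)"
    using xs(1) adj \<open>xs \<noteq> []\<close> hd_in_set[of xs] last_in_set[of xs]
    by (auto simp: distinct_adj_append_iff distinct_adj_Cons)
  hence run: "apply_string (hub_graph V {c}, \<beta>) (tour c ?bs) = (hub_graph V {c}, flip V \<beta>)" for \<beta>
    using apply_tour[of c V ?bs] bs assms(3) by (simp del: set_append)
  have "flip V \<beta> = (\<lambda>x \<in> V. - \<beta> x)" if "\<beta> \<in> bicolorings (hub_graph V {c})" for \<beta>
    using that by (auto simp: flip_def bicolorings_def hub_graph_def fun_eq_iff PiE_def extensional_def)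
  moreover have "set (tour c ?bs) \<subseteq> V"
    using set_tour[of c ?bs] bs assms(3) by auto
  ultimately have "color_reversing (hub_graph V {c}) (tour c ?bs)"
    using run by (simp add: color_reversing_def hub_graph_def)
  moreover have "length (tour c ?bs) = 3 * card V"
    using len by (simp add: length_tour)
  ultimately show ?thesis by blast
qed

section \<open>The color-reversal number of a star\<close>

theorem theorem4:
  fixes n :: nat and G :: "'a graph"
  assumes "n \<ge> 3" and "is_star n G"
  shows "cr G = enat (3 * n)"
proof -
  from assms(2) obtain V c
    where G: "finite V" "card V = n" "c \<in> V" "G = hub_graph V {c}"
    by (rule is_starE)
  obtain w where w: "color_reversing G w" "length w = 3 * n"
    using color_reversing_string_exists[of V c] G assms(1) by auto
  show ?thesis
  proof (rule antisym)
    show "cr G \<le> enat (3 * n)"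
      unfolding cr_def using w by (intro INF_lower2[of w]) auto
    show "enat (3 * n) \<le> cr G"
      unfolding cr_def using color_reversing_length[of V c] G assms(1) by (auto intro!: INF_greatest)
  qed
qed

end
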